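(* Let $f\in\mathcal W_\infty$ and let $\{a_n:n\in\mathbb N\}$ be a sequence of elements of an abelian topological group. Then $\{a_n:n\in\mathbb N\}$ is $f$-summable if and only if it is $f^\star$-summable, and $\{a_n:n\in\mathbb N\}$ is $f$-Cauchy summable if and only if it is $f^\star$-Cauchy summable.
   Context: All topological groups are Hausdorff; $\mathbb N=\{0,1,2,\dots\}$; $\omega$ is the first infinite ordinal, $\omega+1=\mathbb N\cup\{\omega\}$, $n<\omega$ for $n\in\mathbb N$. $\mathcal W_\infty$ is the set of all functions $f:\mathbb N\to(\omega+1)\setminus\{0\}$. A sequence $\{x_n\}$ in an abelian topological group (written additively) is Cauchy if for every neighbourhood $U$ of $0$ there is $k$ with $x_m-x_l\in U$ for all $l,m\ge k$. A sequence $\{b_n:n\in\mathbb N\}$ in an abelian topological group $G$ is summable (Cauchy summable) if $\{\sum_{n=0}^m b_n:m\in\mathbb N\}$ converges to some element of $G$ (respectively, is Cauchy). A sequence $\{a_n:n\in\mathbb N\}$ in $G$ is $f$-summable ($f$-Cauchy summable) if it is faithfully indexed ($a_n\ne a_m$ for $n\ne m$) and $\{z(n)a_n:n\in\mathbb N\}$ is summable (respectively, Cauchy summable) for every $z:\mathbb N\to\mathbb Z$ with $|z(n)|\le f(n)$ for all $n$. It is $f^\star$-summable ($f^\star$-Cauchy summable) if it is faithfully indexed and $\{z(n)a_n:n\in\mathbb N\}$ is summable (respectively, Cauchy summable) for every $z:\mathbb N\to\mathbb N$ with $z(n)\le f(n)$ for all $n$. *)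

theory Defs
  imports Complex_Main "HOL-Library.Extended_Nat"
begin

text \<open>
  Abelian topological groups are rendered by the class \<open>topological_ab_group_add\<close>;
  the Hausdorff axiom is the additional class \<open>t2_space\<close>.
  The ordinal \<open>\<omega> + 1\<close> is rendered by \<^typ>\<open>enat\<close>, with \<open>\<omega>\<close> being \<^term>\<open>\<infinity>::enat\<close>.
\<close>

definition W_infty :: "(nat \<Rightarrow> enat) set" where
  "W_infty = {f. \<forall>n. f n \<noteq> 0}"

definition int_mult :: "int \<Rightarrow> 'a::ab_group_add \<Rightarrow> 'a" where
  "int_mult k a = (if k \<ge> 0 then (\<Sum>i<nat k. a) else - (\<Sum>i<nat (- k). a))"

text \<open>
  The library's \<^const>\<open>Cauchy\<close> is tied to the class \<open>uniform_space\<close>. The uniformity of a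
  topological group is determined by its topology, so the notion is stated here by means
  of the neighbourhoods of \<open>0\<close> alone.
\<close>

definition group_Cauchy :: "(nat \<Rightarrow> 'a::topological_ab_group_add) \<Rightarrow> bool" where
  "group_Cauchy x \<longleftrightarrow>
    (\<forall>U. (\<forall>\<^sub>F y in nhds 0. y \<in> U) \<longrightarrow> (\<exists>k. \<forall>l\<ge>k. \<forall>m\<ge>k. x m - x l \<in> U))"

definition Cauchy_summable :: "(nat \<Rightarrow> 'a::topological_ab_group_add) \<Rightarrow> bool" where
  "Cauchy_summable b \<longleftrightarrow> group_Cauchy (\<lambda>m. \<Sum>n\<le>m. b n)"

definition f_summable :: "(nat \<Rightarrow> enat) \<Rightarrow> (nat \<Rightarrow> 'a::topological_ab_group_add) \<Rightarrow> bool" where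
  "f_summable f a \<longleftrightarrow> inj a \<and>
    (\<forall>z :: nat \<Rightarrow> int. (\<forall>n. enat (nat \<bar>z n\<bar>) \<le> f n) \<longrightarrow> summable (\<lambda>n. int_mult (z n) (a n)))"

definition f_Cauchy_summable :: "(nat \<Rightarrow> enat) \<Rightarrow> (nat \<Rightarrow> 'a::topological_ab_group_add) \<Rightarrow> bool" where
  "f_Cauchy_summable f a \<longleftrightarrow> inj a \<and>
    (\<forall>z :: nat \<Rightarrow> int. (\<forall>n. enat (nat \<bar>z n\<bar>) \<le> f n) \<longrightarrow> Cauchy_summable (\<lambda>n. int_mult (z n) (a n)))"

definition f_star_summable :: "(nat \<Rightarrow> enat) \<Rightarrow> (nat \<Rightarrow> 'a::topological_ab_group_add) \<Rightarrow> bool" where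
  "f_star_summable f a \<longleftrightarrow> inj a \<and>
    (\<forall>z :: nat \<Rightarrow> nat. (\<forall>n. enat (z n) \<le> f n) \<longrightarrow> summable (\<lambda>n. int_mult (int (z n)) (a n)))"

definition f_star_Cauchy_summable :: "(nat \<Rightarrow> enat) \<Rightarrow> (nat \<Rightarrow> 'a::topological_ab_group_add) \<Rightarrow> bool" where
  "f_star_Cauchy_summable f a \<longleftrightarrow> inj a \<and>
    (\<forall>z :: nat \<Rightarrow> nat. (\<forall>n. enat (z n) \<le> f n) \<longrightarrow> Cauchy_summable (\<lambda>n. int_mult (int (z n)) (a n)))"

end

theory Submission
  imports Defs
begin

text \<open>Natural coefficients are special integer coefficients, so one direction is immediate.
  Conversely, split an integer coefficient sequence \<open>z\<close> into its positive and negative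
  parts. Both are natural sequences bounded by \<open>\<bar>z n\<bar>\<close>, hence by
  \<open>f n\<close>, so both resulting series are summable (or Cauchy summable), and the series for
  \<open>z\<close> is their termwise difference. It remains that both kinds of summability pass to
  differences; partial sums of a difference are differences of partial sums, so this comes from the
  continuity of subtraction: \<open>summable_diff_topological_group\<close> and
  \<open>Cauchy_summable_diff\<close>.\<close>

lemma int_mult_pos_part_minus_neg_part:
  "int_mult k a = int_mult (int (nat k)) a - int_mult (int (nat (- k))) a"
  by (simp add: int_mult_def)

lemma summable_diff_topological_group:
  fixes b c :: "nat \<Rightarrow> 'a::topological_ab_group_add"
  assumes "summable b" "summable c"
  shows "summable (\<lambda>n. b n - c n)"
proof -
  from assms obtain s t where "b sums s" "c sums t"
    by (auto simp: summable_def)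
  then have "(\<lambda>n. b n - c n) sums (s - t)"
    unfolding sums_def sum_subtractf by (rule tendsto_diff)
  then show ?thesis
    by (rule sums_summable)
qed

text \<open>The increments of the difference regroup as \<open>(x m - x l) - (y m - y l)\<close>,
  and continuity of subtraction at the origin makes this small once both brackets are small.\<close>

lemma group_Cauchy_diff:
  fixes x y :: "nat \<Rightarrow> 'a::topological_ab_group_add"
  assumes "group_Cauchy x" "group_Cauchy y"
  shows "group_Cauchy (\<lambda>n. x n - y n)"
  unfolding group_Cauchy_def
proof (intro allI impI)
  fix U :: "'a set"
  assume U: "\<forall>\<^sub>F u in nhds 0. u \<in> U"
  \<comment> \<open>Continuity of subtraction at \<open>(0, 0)\<close>, phrased with a product
    filter so that \<open>eventually_prod_filter\<close> yields neighbourhoods \<open>P\<close> and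
    \<open>Q\<close> of \<open>0\<close> whose differences lie in \<open>U\<close>.\<close>
  have "((\<lambda>p. fst p - snd p) \<longlongrightarrow> 0 - (0::'a)) (nhds 0 \<times>\<^sub>F nhds 0)"
    by (intro tendsto_diff) (simp_all add: filterlim_def filtermap_fst_prod_filter filtermap_snd_prod_filter)
  then have "((\<lambda>p. fst p - snd p) \<longlongrightarrow> (0::'a)) (nhds 0 \<times>\<^sub>F nhds 0)"
    by simp
  from eventually_compose_filterlim[OF U this]
  have "\<forall>\<^sub>F p in nhds 0 \<times>\<^sub>F nhds 0. fst p - snd p \<in> U" .
  then obtain P Q where P: "eventually P (nhds 0)" and Q: "eventually Q (nhds 0)"
    and PQ: "\<And>u v. P u \<Longrightarrow> Q v \<Longrightarrow> u - v \<in> U"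
    by (auto simp: eventually_prod_filter)
  obtain k where k: "\<And>l m. k \<le> l \<Longrightarrow> k \<le> m \<Longrightarrow> P (x m - x l)"
    using assms(1)[unfolded group_Cauchy_def, rule_format, of "Collect P"] P by auto
  obtain k' where k': "\<And>l m. k' \<le> l \<Longrightarrow> k' \<le> m \<Longrightarrow> Q (y m - y l)"
    using assms(2)[unfolded group_Cauchy_def, rule_format, of "Collect Q"] Q by auto
  have "x m - y m - (x l - y l) \<in> U" if "max k k' \<le> l" "max k k' \<le> m" for l m
    using PQ[OF k k', of l m l m] that by (simp add: algebra_simps)
  then show "\<exists>k. \<forall>l\<ge>k. \<forall>m\<ge>k. x m - y m - (x l - y l) \<in> U"
    by blast
qed

lemma Cauchy_summable_diff:
  assumes "Cauchy_summable b" "Cauchy_summable c"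
  shows "Cauchy_summable (\<lambda>n. b n - c n)"
  using assms unfolding Cauchy_summable_def sum_subtractf by (rule group_Cauchy_diff)

text \<open>The predicate \<open>S\<close> is kept abstract so that one argument serves both
  \<open>summable\<close> and \<open>Cauchy_summable\<close>; all it uses of \<open>S\<close> is
  closure under termwise differences.\<close>

lemma all_int_coeffs_iff_all_nat_coeffs:
  fixes a :: "nat \<Rightarrow> 'a::ab_group_add"
  assumes diff: "\<And>b c. S b \<Longrightarrow> S c \<Longrightarrow> S (\<lambda>n. b n - c n)"
  shows "(\<forall>z :: nat \<Rightarrow> int. (\<forall>n. enat (nat \<bar>z n\<bar>) \<le> f n) \<longrightarrow> S (\<lambda>n. int_mult (z n) (a n))) \<longleftrightarrow>
         (\<forall>z :: nat \<Rightarrow> nat. (\<forall>n. enat (z n) \<le> f n) \<longrightarrow> S (\<lambda>n. int_mult (int (z n)) (a n)))"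
    (is "?int \<longleftrightarrow> ?nat")
proof
  assume int: ?int
  show ?nat
  proof (intro allI impI)
    fix z :: "nat \<Rightarrow> nat"
    assume "\<forall>n. enat (z n) \<le> f n"
    then show "S (\<lambda>n. int_mult (int (z n)) (a n))"
      using int[rule_format, of "\<lambda>n. int (z n)"] by simp
  qed
next
  assume nat: ?nat
  show ?int
  proof (intro allI impI)
    fix z :: "nat \<Rightarrow> int"
    assume z: "\<forall>n. enat (nat \<bar>z n\<bar>) \<le> f n"
    \<comment> \<open>\<open>nat\<close> truncates negative integers to \<open>0\<close>, so these
      are the positive and negative parts of \<open>z n\<close>, each at most
      \<open>\<bar>z n\<bar>\<close>.\<close>
    have "enat (nat (z n)) \<le> f n" "enat (nat (- z n)) \<le> f n" for n
      by (rule order_trans[OF _ z[rule_format]], simp)+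
    then have "S (\<lambda>n. int_mult (int (nat (z n))) (a n))"
      and "S (\<lambda>n. int_mult (int (nat (- z n))) (a n))"
      by (intro nat[rule_format]; simp)+
    from diff[OF this] show "S (\<lambda>n. int_mult (z n) (a n))"
      by (simp only: int_mult_pos_part_minus_neg_part[symmetric])
  qed
qed

theorem proposition3p10:
  fixes f :: "nat \<Rightarrow> enat"
    and a :: "nat \<Rightarrow> 'a::{topological_ab_group_add, t2_space}"
  assumes "f \<in> W_infty"
  shows "(f_summable f a \<longleftrightarrow> f_star_summable f a) \<and>
         (f_Cauchy_summable f a \<longleftrightarrow> f_star_Cauchy_summable f a)"
  unfolding f_summable_def f_star_summable_def f_Cauchy_summable_def f_star_Cauchy_summable_def
  by (simp only: all_int_coeffs_iff_all_nat_coeffs[of summable, OF summable_diff_topological_group]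
      all_int_coeffs_iff_all_nat_coeffs[of Cauchy_summable, OF Cauchy_summable_diff])

end
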